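(* Suppose that $x_{i,j}\in\mathcal D$ for all $1\le i\le m$, $1\le j\le n_i$. Let $\theta\in\Theta^m$ be non-decreasing with $I(\theta)=0$, $\ell(\theta\mid\mathbf x)>0$, and $\ell(\lambda\mid\mathbf x)\le\ell(\theta\mid\mathbf x)$ for all non-decreasing $\lambda\in\Theta^m$. Let $\tau_1<\tau_2<\dots<\tau_s$ be a complete listing of the distinct components of $\theta$, and for $r\in[1\dots s]$ set $A_r=\{i\in[1\dots m]:\theta_i=\tau_r\}$. Then for every $r\in[1\dots s]$: (i) There are integers $a_r\le b_r$ in $[1\dots m]$ such that $A_r=[a_r\dots b_r]$. (ii) Let $\kappa_r=\min\{\mu[a_r\dots k]: k\in[a_r\dots m]\}$ and $t_r=\max\{k\in[a_r\dots m]:\mu[a_r\dots k]=\kappa_r\}$. Then $t_r=b_r$.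
   Context: Setting. $\{f(x\mid\theta):\theta\in\Theta\}$ is a one-parameter family of probability density functions on $\mathbb R$, with $\Theta\subset\mathbb R$. Put $\mathcal D=\{x\in\mathbb R: (\exists\theta\in\Theta)\ f(x\mid\theta)>0\}$; elements of $\mathcal D$ are called observable. Standing assumptions: (1) Either all the $f(\cdot\mid\theta)$ are PDFs (probability mass functions) of discrete real random variables, or all of them are PDFs of absolutely continuous real random variables; in particular $f\ge 0$. (2) $\mathcal D\subset\Theta$ and $\Theta$ is a real interval of positive length. (3) For every $t\ge1$ and all $y_1,\dots,y_t\in\mathcal D$, with arithmetic mean $\overline y$, the function $\theta\mapsto L(\theta\mid\mathbf y)=\prod_{s=1}^t f(y_s\mid\theta)$ is strictly increasing on $\{\theta\in\Theta:\theta\le\overline y\}$ and strictly decreasing on $\{\theta\in\Theta:\theta\ge\overline y\}$. Data. $m\ge1$ and $n_1,\dots,n_m\ge1$ are integers, and $\mathbf x=(x_{i,j})_{1\le i\le m,\,1\le j\le n_i}$ is a doubly-indexed vector of real numbers (observations of independent random variables $X_{i,j}$ with PDF $f(\cdot\mid\theta_i)$). For $\lambda=\langle\lambda_1,\dots,\lambda_m\rangle\in\Theta^m$, the compound likelihood is $\ell(\lambda\mid\mathbf x)=\prod_{i=1}^m\prod_{j=1}^{n_i}f(x_{i,j}\mid\lambda_i)$. A vector $\lambda\in\Theta^m$ is non-decreasing if $i\le k$ implies $\lambda_i\le\lambda_k$. Notation. $[a\dots b]$ is the set of integers in the real interval $[a,b]$. For nonempty $J\subset[1\dots m]$, $\mu(J)=\dfrac{\sum_{i\in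 J}\sum_{j=1}^{n_i}x_{i,j}}{\sum_{i\in J}n_i}$; $\mu[a\dots b]$ means $\mu([a\dots b])$. Index. For $\theta\in\Theta^m$ let $\tau_1,\dots,\tau_s$ list the distinct components of $\theta$ without repetition, and let $A_t=\{i\in[1\dots m]:\theta_i=\tau_t\}$. The index $I(\theta)$ is the number of $t\in[1\dots s]$ such that $\tau_t\ne\mu(A_t)$. *)

theory Defs
  imports "HOL-Probability.Probability"
begin

text \<open>
  A family is given as \<open>f :: real \<Rightarrow> real \<Rightarrow> real\<close>, where \<open>f x \<theta>\<close> stands for the density f(x | theta).
  Only its values for \<open>\<theta> \<in> \<Theta>\<close> matter.
\<close>

definition discrete_density :: "(real \<Rightarrow> real) \<Rightarrow> bool" where
  "discrete_density g \<longleftrightarrow> (\<exists>p :: real pmf. \<forall>x. g x = pmf p x)"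

text \<open>
  Densities need only be Lebesgue measurable; a density measure over \<open>lebesgue\<close> covers the
  Borel measurable case as well.  Nonnegativity has to be required separately because
  \<open>ennreal\<close> truncates negative values to zero.
\<close>

definition continuous_density :: "(real \<Rightarrow> real) \<Rightarrow> bool" where
  "continuous_density g \<longleftrightarrow>
     (\<forall>x. 0 \<le> g x) \<and> g \<in> borel_measurable lebesgue \<and>
     prob_space (density lebesgue (\<lambda>x. ennreal (g x)))"

definition observable :: "(real \<Rightarrow> real \<Rightarrow> real) \<Rightarrow> real set \<Rightarrow> real set" where
  "observable f \<Theta> = {x. \<exists>\<theta>\<in>\<Theta>. f x \<theta> > 0}"

definition likelihood :: "(real \<Rightarrow> real \<Rightarrow> real) \<Rightarrow> nat \<Rightarrow> (nat \<Rightarrow> real) \<Rightarrow> real \<Rightarrow> real" where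
  "likelihood f t y \<theta> = (\<Prod>s=1..t. f (y s) \<theta>)"

definition arith_mean :: "nat \<Rightarrow> (nat \<Rightarrow> real) \<Rightarrow> real" where
  "arith_mean t y = (\<Sum>s=1..t. y s) / real t"

definition admissible_family :: "(real \<Rightarrow> real \<Rightarrow> real) \<Rightarrow> real set \<Rightarrow> bool" where
  "admissible_family f \<Theta> \<longleftrightarrow>
     ((\<forall>\<theta>\<in>\<Theta>. discrete_density (\<lambda>x. f x \<theta>)) \<or>
      (\<forall>\<theta>\<in>\<Theta>. continuous_density (\<lambda>x. f x \<theta>))) \<and>
     observable f \<Theta> \<subseteq> \<Theta> \<and>
     is_interval \<Theta> \<and> (\<exists>a\<in>\<Theta>. \<exists>b\<in>\<Theta>. a < b) \<and>
     (\<forall>t\<ge>1. \<forall>y. (\<forall>s\<in>{1..t}. y s \<in> observable f \<Theta>) \<longrightarrow>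
        strict_mono_on {\<theta>\<in>\<Theta>. \<theta> \<le> arith_mean t y} (likelihood f t y) \<and>
        strict_antimono_on {\<theta>\<in>\<Theta>. \<theta> \<ge> arith_mean t y} (likelihood f t y))"

text \<open>
  Vectors indexed by \<open>{1..m}\<close> are functions on \<open>nat\<close>, of which only the values on \<open>{1..m}\<close>
  are used; similarly the data \<open>x i j\<close> are used only for \<open>1 \<le> i \<le> m\<close> and \<open>1 \<le> j \<le> n i\<close>.
\<close>

definition compound_likelihood ::
  "(real \<Rightarrow> real \<Rightarrow> real) \<Rightarrow> nat \<Rightarrow> (nat \<Rightarrow> nat) \<Rightarrow> (nat \<Rightarrow> nat \<Rightarrow> real) \<Rightarrow> (nat \<Rightarrow> real) \<Rightarrow> real" where
  "compound_likelihood f m n x \<nu> = (\<Prod>i=1..m. \<Prod>j=1..n i. f (x i j) (\<nu> i))"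

definition pooled_mean :: "(nat \<Rightarrow> nat) \<Rightarrow> (nat \<Rightarrow> nat \<Rightarrow> real) \<Rightarrow> nat set \<Rightarrow> real" where
  "pooled_mean n x J = (\<Sum>i\<in>J. \<Sum>j=1..n i. x i j) / real (\<Sum>i\<in>J. n i)"

definition level_set :: "nat \<Rightarrow> (nat \<Rightarrow> real) \<Rightarrow> real \<Rightarrow> nat set" where
  "level_set m \<theta> \<tau> = {i\<in>{1..m}. \<theta> i = \<tau>}"

definition mean_index :: "nat \<Rightarrow> (nat \<Rightarrow> nat) \<Rightarrow> (nat \<Rightarrow> nat \<Rightarrow> real) \<Rightarrow> (nat \<Rightarrow> real) \<Rightarrow> nat" where
  "mean_index m n x \<theta> = card {\<tau> \<in> \<theta> ` {1..m}. \<tau> \<noteq> pooled_mean n x (level_set m \<theta> \<tau>)}"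

end

theory Submission
  imports Defs
begin

text \<open>
  If an initial piece \<open>J\<close> of a level set of \<open>\<theta>\<close> had pooled mean below the common value \<open>t\<close> there,
  one could lower \<open>\<theta>\<close> slightly on \<open>J\<close>, staying above the pooled mean of \<open>J\<close> and above all smaller
  values of \<open>\<theta>\<close>; this keeps \<open>\<theta>\<close> monotone and strictly increases the likelihood.  So every such
  piece satisfies \<open>\<Sum>i\<in>J. \<Sum>j. (x i j - \<theta> i) \<ge> 0\<close>.  If \<open>a\<close> is the start of a level set, \<open>{a..k}\<close> is a
  disjoint union of such pieces, whence \<open>\<mu>[a..k] \<ge> \<theta> a\<close>, and the inequality is strict as soon as
  \<open>\<theta> k > \<theta> a\<close>.  Equality at the end of the level set is the hypothesis of index zero.
\<close>

lemma admissible_nonneg: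
  assumes "admissible_family f \<Theta>" "\<theta> \<in> \<Theta>"
  shows "0 \<le> f x \<theta>"
proof -
  have "discrete_density (\<lambda>x. f x \<theta>) \<or> continuous_density (\<lambda>x. f x \<theta>)"
    using assms unfolding admissible_family_def by blast
  then show ?thesis
    by (auto simp: discrete_density_def continuous_density_def)
qed

text \<open>The arithmetic mean is the convex combination with all weights equal to
  \<open>1 / real t\<close>.\<close>

lemma arith_mean_in_convex:
  assumes "convex S" "t \<ge> 1" "\<And>s. s \<in> {1..t} \<Longrightarrow> y s \<in> S"
  shows "arith_mean t y \<in> S"
proof -
  have "(\<Sum>s\<in>{1..t}. (1 / real t) *\<^sub>R y s) \<in> S"
    by (rule convex_sum) (use assms in auto)
  moreover have "(\<Sum>s\<in>{1..t}. (1 / real t) *\<^sub>R y s) = arith_mean t y"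
    by (simp add: arith_mean_def sum_divide_distrib)
  ultimately show ?thesis by simp
qed

text \<open>Monotonicity of the likelihood is assumed for singly indexed samples. Enumerating the
  index pairs over \<open>J\<close> by a bijection with \<open>{1..card P}\<close> turns a block of
  data into such a sample; one enumeration serves every density and parameter.\<close>

lemma double_index_enum:
  fixes x :: "nat \<Rightarrow> nat \<Rightarrow> real"
  assumes "finite J" "J \<noteq> {}" and n: "\<And>i. i \<in> J \<Longrightarrow> n i \<ge> 1"
  obtains t y where "t \<ge> 1"
    and "\<And>s. s \<in> {1..t} \<Longrightarrow> \<exists>i\<in>J. \<exists>j\<in>{1..n i}. y s = x i j"
    and "arith_mean t y = pooled_mean n x J"
    and "\<And>f \<theta>. likelihood f t y \<theta> = (\<Prod>i\<in>J. \<Prod>j=1..n i. f (x i j) \<theta>)"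
proof -
  define P where "P = (SIGMA i:J. {1..n i})"
  have fin: "finite P" using assms by (auto simp: P_def)
  have "P \<noteq> {}" using assms by (force simp: P_def)
  have card: "card P = (\<Sum>i\<in>J. n i)" using assms by (simp add: P_def)
  obtain h where h: "bij_betw h {1..card P} P"
    using ex_bij_betw_nat_finite_1[OF fin] by blast
  define y where "y = (\<lambda>s. case h s of (i, j) \<Rightarrow> x i j)"
  have "(\<Sum>s=1..card P. y s) = (\<Sum>(i, j)\<in>P. x i j)"
    unfolding y_def by (rule sum.reindex_bij_betw[OF h])
  also have "\<dots> = (\<Sum>i\<in>J. \<Sum>j=1..n i. x i j)"
    unfolding P_def using assms by (subst sum.Sigma) auto
  finally have mean: "arith_mean (card P) y = pooled_mean n x J"
    by (simp add: arith_mean_def pooled_mean_def card)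
  have prod: "likelihood f (card P) y \<theta> = (\<Prod>i\<in>J. \<Prod>j=1..n i. f (x i j) \<theta>)" for f \<theta>
  proof -
    have "likelihood f (card P) y \<theta> = (\<Prod>s=1..card P. (\<lambda>(i, j). f (x i j) \<theta>) (h s))"
      by (simp add: likelihood_def y_def case_prod_beta)
    also have "\<dots> = (\<Prod>(i, j)\<in>P. f (x i j) \<theta>)"
      by (rule prod.reindex_bij_betw[OF h])
    also have "\<dots> = (\<Prod>i\<in>J. \<Prod>j=1..n i. f (x i j) \<theta>)"
      unfolding P_def using assms by (subst prod.Sigma) auto
    finally show ?thesis .
  qed
  show thesis
  proof (rule that[of "card P" y])
    show "card P \<ge> 1" using fin \<open>P \<noteq> {}\<close> by (simp add: Suc_le_eq card_gt_0_iff)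
    fix s assume "s \<in> {1..card P}"
    then have "h s \<in> P" using h by (auto dest: bij_betwE)
    then show "\<exists>i\<in>J. \<exists>j\<in>{1..n i}. y s = x i j"
      unfolding P_def y_def by fastforce
  qed (use mean prod in auto)
qed

text \<open>After flattening, the block is a single observable sample whose mean is the pooled mean.
  This mean stays in \<Theta> because the observable values lie in the convex set \<Theta>.\<close>

lemma pooled_likelihood:
  assumes adm: "admissible_family f \<Theta>"
    and J: "finite J" "J \<noteq> {}" "\<And>i. i \<in> J \<Longrightarrow> n i \<ge> 1"
    and obs: "\<And>i j. i \<in> J \<Longrightarrow> j \<in> {1..n i} \<Longrightarrow> x i j \<in> observable f \<Theta>"
  shows pooled_mean_in: "pooled_mean n x J \<in> \<Theta>"
    and pooled_likelihood_antimono: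
      "strict_antimono_on {\<theta>\<in>\<Theta>. \<theta> \<ge> pooled_mean n x J} (\<lambda>\<theta>. \<Prod>i\<in>J. \<Prod>j=1..n i. f (x i j) \<theta>)"
proof -
  obtain t y where t: "t \<ge> 1"
    and y: "\<And>s. s \<in> {1..t} \<Longrightarrow> \<exists>i\<in>J. \<exists>j\<in>{1..n i}. y s = x i j"
    and mean: "arith_mean t y = pooled_mean n x J"
    and L: "\<And>f \<theta>. likelihood f t y \<theta> = (\<Prod>i\<in>J. \<Prod>j=1..n i. f (x i j) \<theta>)"
    using double_index_enum[where n=n and x=x, OF J] by blast
  have y_obs: "y s \<in> observable f \<Theta>" if "s \<in> {1..t}" for s
    using y[OF that] obs by auto
  have "convex \<Theta>" and sub: "observable f \<Theta> \<subseteq> \<Theta>"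
    using adm by (auto simp: admissible_family_def is_interval_convex_1)
  then have "arith_mean t y \<in> \<Theta>"
    using y_obs t by (intro arith_mean_in_convex) auto
  then show "pooled_mean n x J \<in> \<Theta>" by (simp add: mean)
  have "strict_antimono_on {\<theta>\<in>\<Theta>. \<theta> \<ge> arith_mean t y} (likelihood f t y)"
    using adm t y_obs unfolding admissible_family_def by blast
  moreover have "likelihood f t y = (\<lambda>\<theta>. \<Prod>i\<in>J. \<Prod>j=1..n i. f (x i j) \<theta>)"
    by (rule ext) (rule L)
  ultimately show "strict_antimono_on {\<theta>\<in>\<Theta>. \<theta> \<ge> pooled_mean n x J}
      (\<lambda>\<theta>. \<Prod>i\<in>J. \<Prod>j=1..n i. f (x i j) \<theta>)"
    by (simp add: mean)
qed

text \<open>The factors outside \<open>J\<close> are the same on both sides. The factor of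
  \<open>J\<close> grows strictly as its common parameter moves from \<open>t\<close> down toward
  the pooled mean without passing it.\<close>

lemma compound_likelihood_update_greater:
  assumes adm: "admissible_family f \<Theta>"
    and J: "J \<subseteq> {1..m}" "J \<noteq> {}" "\<And>i. i \<in> J \<Longrightarrow> n i \<ge> 1"
    and obs: "\<And>i j. i \<in> J \<Longrightarrow> j \<in> {1..n i} \<Longrightarrow> x i j \<in> observable f \<Theta>"
    and \<theta>: "\<theta> \<in> {1..m} \<rightarrow> \<Theta>" "\<And>i. i \<in> J \<Longrightarrow> \<theta> i = t"
    and pos: "compound_likelihood f m n x \<theta> > 0"
    and v: "v \<in> \<Theta>" "pooled_mean n x J \<le> v" "v < t"
  shows "compound_likelihood f m n x \<theta> < compound_likelihood f m n x (\<lambda>i. if i \<in> J then v else \<theta> i)"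
proof -
  define g where "g = (\<lambda>i c. \<Prod>j=1..n i. f (x i j) c)"
  define R where "R = (\<Prod>i\<in>{1..m} - J. g i (\<theta> i))"
  have finJ: "finite J" using J finite_subset by blast
  have "t \<in> \<Theta>" using J \<theta> by (metis Pi_iff ex_in_conv subsetD)
  then have less: "(\<Prod>i\<in>J. g i t) < (\<Prod>i\<in>J. g i v)"
    unfolding g_def
    using monotone_onD[OF pooled_likelihood_antimono[where n=n and x=x, OF adm finJ J(2,3) obs], of v t] v
    by simp
  have split: "compound_likelihood f m n x \<nu> = (\<Prod>i\<in>{1..m} - J. g i (\<nu> i)) * (\<Prod>i\<in>J. g i (\<nu> i))" for \<nu>
    unfolding compound_likelihood_def g_def
    by (rule prod.subset_diff[OF J(1)]) simp
  have at_\<theta>: "compound_likelihood f m n x \<theta> = R * (\<Prod>i\<in>J. g i t)"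
    using \<theta>(2) by (simp add: split R_def)
  have at_v: "compound_likelihood f m n x (\<lambda>i. if i \<in> J then v else \<theta> i) = R * (\<Prod>i\<in>J. g i v)"
    by (simp add: split R_def)
  have "R \<ge> 0"
    unfolding R_def g_def using \<theta>(1)
    by (intro prod_nonneg ballI) (auto intro!: admissible_nonneg[OF adm])
  \<comment> \<open>Positivity of the likelihood enters here: a vanishing common factor would
    destroy the strict inequality.\<close>
  moreover have "R \<noteq> 0" using pos at_\<theta> by auto
  ultimately show ?thesis using less by (simp add: at_\<theta> at_v)
qed

text \<open>Inequalities between means do not add over disjoint blocks, but those between residual
  sums do. This identity translates between the two, and the positive weight permits the return to
  means.\<close>

lemma sum_residuals_eq:
  fixes x :: "nat \<Rightarrow> nat \<Rightarrow> real"
  assumes "finite J" "J \<noteq> {}" "\<And>i. i \<in> J \<Longrightarrow> n i \<ge> 1"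
  shows "(\<Sum>i\<in>J. \<Sum>j=1..n i. x i j - c) = real (\<Sum>i\<in>J. n i) * (pooled_mean n x J - c)"
    and "real (\<Sum>i\<in>J. n i) > 0"
proof -
  show pos: "real (\<Sum>i\<in>J. n i) > 0"
    unfolding of_nat_0_less_iff using assms by (intro sum_pos) (auto simp: Suc_le_eq)
  then show "(\<Sum>i\<in>J. \<Sum>j=1..n i. x i j - c) = real (\<Sum>i\<in>J. n i) * (pooled_mean n x J - c)"
    by (simp add: pooled_mean_def sum_subtractf right_diff_distrib sum_distrib_right
        del: of_nat_sum) (simp add: sum_distrib_right)
qed

lemma pooled_mean_initial_segment_ge:
  assumes adm: "admissible_family f \<Theta>"
    and n: "\<And>i. i \<in> {1..m} \<Longrightarrow> n i \<ge> 1"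
    and obs: "\<And>i j. i \<in> {1..m} \<Longrightarrow> j \<in> {1..n i} \<Longrightarrow> x i j \<in> observable f \<Theta>"
    and \<theta>: "\<theta> \<in> {1..m} \<rightarrow> \<Theta>" and mono: "mono_on {1..m} \<theta>"
    and pos: "compound_likelihood f m n x \<theta> > 0"
    and max: "\<And>\<nu>. \<nu> \<in> {1..m} \<rightarrow> \<Theta> \<Longrightarrow> mono_on {1..m} \<nu> \<Longrightarrow>
            compound_likelihood f m n x \<nu> \<le> compound_likelihood f m n x \<theta>"
    and J: "J = {i \<in> level_set m \<theta> t. i \<le> k}" "J \<noteq> {}"
  shows "t \<le> pooled_mean n x J"
proof (rule ccontr)
  assume "\<not> t \<le> pooled_mean n x J"
  then have lt: "pooled_mean n x J < t" by simp
  \<comment> \<open>\<open>V\<close> collects the lower bounds that the new value must respect: the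
    pooled mean, and the values of \<theta> below \<open>t\<close>. All of them lie in \<Theta> and
    below \<open>t\<close>, so their maximum \<open>v\<close> does too. The pooled mean keeps
    \<open>V\<close> nonempty when \<open>t\<close> is the least value of \<theta>.\<close>
  define V where "V = insert (pooled_mean n x J) {c \<in> \<theta> ` {1..m}. c < t}"
  define v where "v = Max V"
  have sub: "J \<subseteq> {1..m}" using J by (auto simp: level_set_def)
  then have finJ: "finite J" by (rule finite_subset) simp
  have J\<theta>: "\<theta> i = t" if "i \<in> J" for i using that J by (auto simp: level_set_def)
  have nJ: "n i \<ge> 1" if "i \<in> J" for i using that sub n by blast
  have obsJ: "x i j \<in> observable f \<Theta>" if "i \<in> J" "j \<in> {1..n i}" for i j
    using that sub obs by blast
  have "pooled_mean n x J \<in> \<Theta>" by (rule pooled_mean_in[OF adm finJ J(2) nJ obsJ])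
  then have "V \<subseteq> \<Theta>" using \<theta> by (auto simp: V_def)
  have V: "finite V" "V \<noteq> {}" by (auto simp: V_def)
  have "v \<in> V" unfolding v_def by (rule Max_in[OF V])
  then have v: "v \<in> \<Theta>" "v < t" using \<open>V \<subseteq> \<Theta>\<close> lt by (auto simp: V_def)
  have v_ge: "pooled_mean n x J \<le> v"
    unfolding v_def using V by (intro Max_ge) (auto simp: V_def)
  have below: "\<theta> i \<le> v" if "i \<in> {1..m}" "\<theta> i < t" for i
    unfolding v_def using that V by (intro Max_ge) (auto simp: V_def)
  let ?\<nu> = "\<lambda>i. if i \<in> J then v else \<theta> i"
  have "mono_on {1..m} ?\<nu>"
  proof (rule mono_onI)
    fix i i' assume i: "i \<in> {1..m}" "i' \<in> {1..m}" "i \<le> i'"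
    then have le: "\<theta> i \<le> \<theta> i'" using mono by (simp add: mono_onD)
    show "?\<nu> i \<le> ?\<nu> i'"
    proof (cases "i \<in> J"; cases "i' \<in> J")
      assume *: "i \<in> J" "i' \<notin> J"
      then show ?thesis using J\<theta>[of i] le v(2) by simp
    next
      assume *: "i \<notin> J" "i' \<in> J"
      \<comment> \<open>Here it matters that \<open>J\<close> is an initial piece: since
        \<open>i \<le> i' \<le> k\<close>, value \<open>t\<close> at \<open>i\<close> would put
        \<open>i\<close> into \<open>J\<close>.\<close>
      then have "\<theta> i \<noteq> t" using J(1) i by (auto simp: level_set_def)
      then have "\<theta> i < t" using le J\<theta>[of i'] * by simp
      then show ?thesis using below i * by simp
    qed (use le in auto)
  qed
  moreover have "?\<nu> \<in> {1..m} \<rightarrow> \<Theta>" using \<theta> v by auto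
  ultimately have "compound_likelihood f m n x ?\<nu> \<le> compound_likelihood f m n x \<theta>"
    by (rule max[rotated])
  moreover have "compound_likelihood f m n x \<theta> < compound_likelihood f m n x ?\<nu>"
    by (rule compound_likelihood_update_greater[OF adm sub J(2) nJ obsJ \<theta> J\<theta> pos v(1) v_ge v(2)])
  ultimately show False by simp
qed

text \<open>Between the least and the greatest index of the level set, monotonicity squeezes the
  value between \<open>t\<close> and \<open>t\<close>.\<close>

lemma mono_on_level_set_interval:
  assumes mono: "mono_on {1..m} \<theta>" and ne: "level_set m \<theta> t \<noteq> {}"
  obtains a b where "a \<in> {1..m}" "b \<in> {1..m}" "a \<le> b" "level_set m \<theta> t = {a..b}"
proof -
  let ?A = "level_set m \<theta> t"
  have fin: "finite ?A" by (simp add: level_set_def)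
  have "Min ?A \<in> ?A" "Max ?A \<in> ?A" using fin ne by auto
  then have ends: "Min ?A \<in> {1..m}" "\<theta> (Min ?A) = t" "Max ?A \<in> {1..m}" "\<theta> (Max ?A) = t"
    unfolding level_set_def by blast+
  have "{Min ?A..Max ?A} \<subseteq> ?A"
  proof
    fix i assume i: "i \<in> {Min ?A..Max ?A}"
    then have "i \<in> {1..m}" using ends by auto
    moreover from this i have "\<theta> (Min ?A) \<le> \<theta> i" "\<theta> i \<le> \<theta> (Max ?A)"
      using ends mono_onD[OF mono, of "Min ?A" i] mono_onD[OF mono, of i "Max ?A"] by auto
    ultimately show "i \<in> ?A" using ends by (simp add: level_set_def)
  qed
  then have "?A = {Min ?A..Max ?A}" using fin by auto
  moreover have "Min ?A \<le> Max ?A" using fin ne by simp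
  ultimately show thesis using that ends by blast
qed

theorem theorem2:
  fixes f :: "real \<Rightarrow> real \<Rightarrow> real" and \<Theta> :: "real set"
    and m s :: nat and n :: "nat \<Rightarrow> nat" and x :: "nat \<Rightarrow> nat \<Rightarrow> real"
    and \<theta> \<tau> :: "nat \<Rightarrow> real"
  assumes "admissible_family f \<Theta>"
    and "m \<ge> 1"
    and "\<And>i. i \<in> {1..m} \<Longrightarrow> n i \<ge> 1"
    and "\<And>i j. i \<in> {1..m} \<Longrightarrow> j \<in> {1..n i} \<Longrightarrow> x i j \<in> observable f \<Theta>"
    and "\<theta> \<in> {1..m} \<rightarrow> \<Theta>"
    and "mono_on {1..m} \<theta>"
    and "mean_index m n x \<theta> = 0"
    and "compound_likelihood f m n x \<theta> > 0"
    and "\<And>\<nu>. \<nu> \<in> {1..m} \<rightarrow> \<Theta> \<Longrightarrow> mono_on {1..m} \<nu> \<Longrightarrow>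
            compound_likelihood f m n x \<nu> \<le> compound_likelihood f m n x \<theta>"
    and "strict_mono_on {1..s} \<tau>"
    and "\<tau> ` {1..s} = \<theta> ` {1..m}"
  shows "\<forall>r\<in>{1..s}. \<exists>a\<in>{1..m}. \<exists>b\<in>{1..m}.
           a \<le> b \<and> level_set m \<theta> (\<tau> r) = {a..b} \<and>
           (let \<kappa> = Min {pooled_mean n x {a..k} | k. k \<in> {a..m}};
                t = Max {k \<in> {a..m}. pooled_mean n x {a..k} = \<kappa>}
            in t = b)"
proof
  fix r assume r: "r \<in> {1..s}"
  note adm = assms(1) and n = assms(3) and obs = assms(4) and mono = assms(6)
  define c where "c = \<tau> r"
  have c: "c \<in> \<theta> ` {1..m}" using r assms(11) by (auto simp: c_def)
  then have "level_set m \<theta> c \<noteq> {}" by (auto simp: level_set_def)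
  then obtain a b where ab: "a \<in> {1..m}" "b \<in> {1..m}" "a \<le> b" "level_set m \<theta> c = {a..b}"
    by (rule mono_on_level_set_interval[OF mono])
  have "card {\<tau> \<in> \<theta> ` {1..m}. \<tau> \<noteq> pooled_mean n x (level_set m \<theta> \<tau>)} = 0"
    using assms(7) by (simp only: mean_index_def)
  \<comment> \<open>Cardinality zero means emptiness because the set is finite, being contained in
    the image of \<open>{1..m}\<close>.\<close>
  then have "{\<tau> \<in> \<theta> ` {1..m}. \<tau> \<noteq> pooled_mean n x (level_set m \<theta> \<tau>)} = {}"
    by (subst (asm) card_0_eq) simp_all
  then have mean_b: "pooled_mean n x {a..b} = c" using c ab by force
  have \<theta>_block: "\<theta> i = c" if "i \<in> {a..b}" for i
    using that ab(4) unfolding level_set_def by blast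
  have \<theta>_ge: "c \<le> \<theta> i" if "i \<in> {a..m}" for i
    using that ab \<theta>_block[of a] mono_onD[OF mono, of a i] by auto
  have \<theta>_gt: "c < \<theta> i" if "i \<in> {Suc b..m}" for i
  proof -
    have "i \<notin> level_set m \<theta> c" unfolding ab(4) using that by auto
    then have "\<theta> i \<noteq> c" using that by (auto simp: level_set_def)
    moreover have "c \<le> \<theta> i" using that ab by (intro \<theta>_ge) auto
    ultimately show ?thesis by simp
  qed
  \<comment> \<open>The segment \<open>{a..k}\<close> is split into the fibres \<open>?J d\<close>
    of \<theta>. Each is an initial piece of a level set; the last one may be cut short by
    \<open>k\<close>.\<close>
  have residuals: "0 \<le> (\<Sum>i=a..k. \<Sum>j=1..n i. x i j - \<theta> i)" if k: "k \<in> {a..m}" for k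
  proof -
    let ?J = "\<lambda>d. {i \<in> {a..k}. \<theta> i = d}"
    have "0 \<le> (\<Sum>i\<in>?J d. \<Sum>j=1..n i. x i j - \<theta> i)" if d: "d \<in> \<theta> ` {a..k}" for d
    proof -
      \<comment> \<open>No level set met by \<open>{a..k}\<close> starts before \<open>a\<close>: an
        earlier index has value at most \<open>c\<close>, while \<open>d\<close> is at least
        \<open>c\<close>, so it would belong to \<open>{a..b}\<close>. Hence cutting at
        \<open>a\<close> removes nothing from the fibre.\<close>
      have "i \<ge> a" if "i \<in> {1..m}" "\<theta> i = d" for i
      proof (rule ccontr)
        assume "\<not> a \<le> i"
        then have "\<theta> i \<le> c" using that ab \<theta>_block[of a] mono_onD[OF mono, of i a] by auto
        moreover have "c \<le> d" using d \<theta>_ge k by auto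
        ultimately have "i \<in> level_set m \<theta> c" using that by (simp add: level_set_def)
        then show False using \<open>\<not> a \<le> i\<close> ab by simp
      qed
      then have eq: "?J d = {i \<in> level_set m \<theta> d. i \<le> k}"
        using k ab by (auto simp: level_set_def)
      have ne: "?J d \<noteq> {}" using d by auto
      have "d \<le> pooled_mean n x (?J d)"
        by (rule pooled_mean_initial_segment_ge[OF adm n obs assms(5) mono assms(8,9) eq ne])
      moreover have "n i \<ge> 1" if "i \<in> ?J d" for i using that k ab by (intro n) auto
      ultimately have "0 \<le> (\<Sum>i\<in>?J d. \<Sum>j=1..n i. x i j - d)"
        using sum_residuals_eq(1)[OF _ ne, of n x d] by (simp add: sum_nonneg)
      then show ?thesis by simp
    qed
    then have "0 \<le> (\<Sum>d\<in>\<theta> ` {a..k}. \<Sum>i\<in>?J d. \<Sum>j=1..n i. x i j - \<theta> i)"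
      by (rule sum_nonneg)
    also have "\<dots> = (\<Sum>i=a..k. \<Sum>j=1..n i. x i j - \<theta> i)"
      by (rule sum.image_gen[symmetric]) simp
    finally show ?thesis .
  qed
  \<comment> \<open>Write \<open>x i j - c\<close> as
    \<open>(x i j - \<theta> i) + (\<theta> i - c)\<close>; the second term does not depend on
    \<open>j\<close> and so is counted \<open>n i\<close> times.\<close>
  have split: "real (\<Sum>i=a..k. n i) * (pooled_mean n x {a..k} - c)
      = (\<Sum>i=a..k. \<Sum>j=1..n i. x i j - \<theta> i) + (\<Sum>i=a..k. real (n i) * (\<theta> i - c))"
    and weight: "real (\<Sum>i=a..k. n i) > 0"
    if k: "k \<in> {a..m}" for k
  proof -
    have nk: "n i \<ge> 1" if "i \<in> {a..k}" for i using that k ab by (intro n) auto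
    have ne: "{a..k} \<noteq> {}" using k by simp
    show "real (\<Sum>i=a..k. n i) > 0" by (rule sum_residuals_eq(2)[OF _ ne nk]) simp
    have "real (\<Sum>i=a..k. n i) * (pooled_mean n x {a..k} - c) = (\<Sum>i=a..k. \<Sum>j=1..n i. x i j - c)"
      by (rule sum_residuals_eq(1)[OF _ ne nk, symmetric]) simp
    then show "real (\<Sum>i=a..k. n i) * (pooled_mean n x {a..k} - c)
      = (\<Sum>i=a..k. \<Sum>j=1..n i. x i j - \<theta> i) + (\<Sum>i=a..k. real (n i) * (\<theta> i - c))"
      by (simp add: sum_subtractf sum.distrib algebra_simps)
  qed
  have ge: "c \<le> pooled_mean n x {a..k}" if k: "k \<in> {a..m}" for k
  proof -
    have "0 \<le> (\<Sum>i=a..k. real (n i) * (\<theta> i - c))"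
      using \<theta>_ge k by (intro sum_nonneg mult_nonneg_nonneg) auto
    then have "0 \<le> real (\<Sum>i=a..k. n i) * (pooled_mean n x {a..k} - c)"
      using split[OF k] residuals[OF k] by linarith
    then show ?thesis
      unfolding zero_le_mult_iff using weight[OF k] by linarith
  qed
  have gt: "c < pooled_mean n x {a..k}" if k: "k \<in> {a..m}" "b < k" for k
  proof -
    have "n k \<ge> 1" using k ab by (intro n) auto
    then have "0 < real (n k) * (\<theta> k - c)"
      using \<theta>_gt[of k] k by simp
    moreover have "0 \<le> real (n i) * (\<theta> i - c)" if "i \<in> {a..k}" for i
      using \<theta>_ge[of i] that k by simp
    \<comment> \<open>The single index \<open>k\<close> beyond \<open>b\<close> makes the sum
      strictly positive, all other terms being nonnegative.\<close>
    ultimately have "0 < (\<Sum>i=a..k. real (n i) * (\<theta> i - c))"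
      using k by (intro sum_pos2[of _ k]) auto
    then have "0 < real (\<Sum>i=a..k. n i) * (pooled_mean n x {a..k} - c)"
      using split[OF k(1)] residuals[OF k(1)] by linarith
    then show ?thesis
      unfolding zero_less_mult_iff using weight[OF k(1)] by linarith
  qed
  have b: "b \<in> {a..m}" using ab by auto
  \<comment> \<open>By \<open>ge\<close>, \<open>c\<close> is a lower bound for the means, and it is
    attained at \<open>b\<close>. By \<open>gt\<close> it is not attained after \<open>b\<close>,
    which settles the maximum below.\<close>
  have min: "Min {pooled_mean n x {a..k} | k. k \<in> {a..m}} = c"
    by (rule Min_eqI) (use ge mean_b b in auto)
  have "Max {k \<in> {a..m}. pooled_mean n x {a..k} = c} = b"
  proof (rule Max_eqI)
    fix k assume "k \<in> {k \<in> {a..m}. pooled_mean n x {a..k} = c}"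
    then show "k \<le> b" using gt[of k] by (cases "b < k") auto
  qed (use mean_b b in auto)
  with min have "let \<kappa> = Min {pooled_mean n x {a..k} | k. k \<in> {a..m}};
      t = Max {k \<in> {a..m}. pooled_mean n x {a..k} = \<kappa>} in t = b"
    by (simp only: Let_def)
  with ab(3,4) show "\<exists>a\<in>{1..m}. \<exists>b\<in>{1..m}. a \<le> b \<and> level_set m \<theta> (\<tau> r) = {a..b} \<and>
      (let \<kappa> = Min {pooled_mean n x {a..k} | k. k \<in> {a..m}};
           t = Max {k \<in> {a..m}. pooled_mean n x {a..k} = \<kappa>}
       in t = b)"
    unfolding c_def by (intro bexI[OF _ ab(1)] bexI[OF _ ab(2)] conjI)
qed

end
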